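(* For every labeled experiment $S\in\mathcal E^e$: (1) there exists a strong-fair computation from $S$; (2) every strong-fair computation from $S$ is weak-fair. Moreover, the converse of (2) fails: there exist $S\in\mathcal E^e$ and a weak-fair computation from $S$ which is not strong-fair.
   Context: Unlabeled processes. Let $\mathcal N$ be an infinite set of names and $\omega\notin\mathcal N$ a special success action. Processes $\mathcal P$: $P::=0\mid x(y).P\mid \bar xy.P\mid P\,|\,P\mid(\nu x)P\mid\, !P$; observers $\mathcal O$: the same grammar extended with $\omega.P$. Binders, $fn$, $bn$, $n(\cdot)$ as usual (alpha-conversion assumed; $fn(\omega)=bn(\omega)=\emptyset$). Actions $\mu$: $xy$, $\bar xy$, $\bar x(y)$, $\tau$ (and $\omega$), with $bn(\bar x(y))=\{y\}$, otherwise empty, $fn(xy)=fn(\bar xy)=\{x,y\}$, $fn(\bar x(y))=\{x\}$, $fn(\tau)=\emptyset$. Transitions: Input $x(y).P\xrightarrow{xz}P\{z/y\}$; Output $\bar xy.P\xrightarrow{\bar xy}P$; $\omega.P\xrightarrow{\omega}P$; Open: $P\xrightarrow{\bar xy}P'$, $x\ne y$ imply $(\nu y)P\xrightarrow{\bar x(y)}P'$; Res: $P\xrightarrow{\mu}P'$, $y\notin n(\mu)$ imply $(\nu y)P\xrightarrow{\mu}(\nu y)P'$; Par: $P\xrightarrow{\mu}P'$, $bn(\mu)\cap fn(Q)=\emptyset$ imply $P|Q\xrightarrow{\mu}P'|Q$; Com: $P\xrightarrow{xy}P'$, $Q\xrightarrow{\bar xy}Q'$ imply $P|Q\xrightarrow{\tau}P'|Q'$;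 Close: $P\xrightarrow{xy}P'$, $Q\xrightarrow{\bar x(y)}Q'$, $y\notin fn(P)$ imply $P|Q\xrightarrow{\tau}(\nu y)(P'|Q')$; symmetric versions of Par, Com, Close; Rep: $P\xrightarrow{\mu}P'$ implies $!P\xrightarrow{\mu}P'|!P$. Labeled terms. Labels are pairs $\langle s,n\rangle\in\{0,1\}^*\times\mathbb N$; $s_0\sqsubseteq s_1$ means $s_0$ is a prefix of $s_1$; for label sets, $L_0\,\Re\,L_1$ iff for all $\langle s_0,n_0\rangle\in L_0$, $\langle s_1,n_1\rangle\in L_1$: $s_0\not\sqsubseteq s_1$ and $s_1\not\sqsubseteq s_0$. Ground labeled terms: $E::=0\mid \mu_{\langle s,n\rangle}.E\mid(\nu x)E\mid E\,|\,E\mid\, !_{\langle s,n\rangle}P\mid \omega.o$, where $\mu$ is a prefix $x(y)$ or $\bar xy$, $P$ is unlabeled, and $o\in\mathcal O$ is an unlabeled observer. Labeling function: $L_{\langle s,n\rangle}(0)=0$; $L_{\langle s,n\rangle}(\mu.P)=\mu_{\langle s,n\rangle}.L_{\langle s,n+1\rangle}(P)$; $L_{\langle s,n\rangle}(P_0|P_1)=L_{\langle s0,n\rangle}(P_0)|L_{\langle s1,n\rangle}(P_1)$; $L_{\langle s,n\rangle}((\nu x)P)=(\nu x)L_{\langle s,n\rangle}(P)$; $L_{\langle s,n\rangle}(!P)=\,!_{\langle s,n\rangle}P$; $L_{\langle s,n\rangle}(\omega.o)=\omega.o$. $top(0)=lab(0)=top(\omega.o)=lab(\omega.o)=\emptyset$;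 $top(\mu_v.E)=\{v\}$, $lab(\mu_v.E)=\{v\}\cup lab(E)$; $top,lab$ of $(\nu x)E$ equal those of $E$; $top$, $lab$ of $E_0|E_1$ are unions; $top(!_vP)=lab(!_vP)=\{v\}$. $wf$ is the least predicate with: $wf(0)$; $wf(\omega.o)$; $wf(L_{\langle s,n\rangle}(\mu.P))$ for every prefixed process/observer $\mu.P$ and label; $wf(E_0|E_1)$ if $wf(E_0)$, $wf(E_1)$, $top(E_0)\,\Re\,top(E_1)$; $wf((\nu x)E)$ if $wf(E)$; $wf(!_{\langle s,n\rangle}P)$ for every $P$ and label. $\mathcal P^e$ (resp. $\mathcal O^e$) is the set of well-formed labeled terms built from processes (resp. observers). The set of labeled experiments is $\mathcal E^e=\{E\,|\,\rho : E\in\mathcal P^e,\rho\in\mathcal O^e\}$. Labeled transitions use the unlabeled rules with labels ignored (e.g. $x(y)_v.E\xrightarrow{xz}E\{z/y\}$, $\bar xy_v.E\xrightarrow{\bar xy}E$, $\omega.o\xrightarrow{\omega}o$), except replication: if $P\xrightarrow{\mu}P'$ (unlabeled) then $!_{\langle s,n\rangle}P\xrightarrow{\mu}L_{\langle s0,n+1\rangle}(P')\,|\,!_{\langle s1,n+1\rangle}P$. Live labels. $live(v,\mu,S)$ is the least predicate closed under: $live(\langle s,n\rangle,xz,x(y)_{\langle s,n\rangle}.S)$; $live(\langle s,n\rangle,\bar xz,\bar xz_{\langle s,n\rangle}.S)$; Res: $live(v,\mu,S)$, $y\notin n(\mu)$ imply $live(v,\mu,(\nu y)S)$; Open: $live(v,\bar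 xy,S)$, $x\ne y$ imply $live(v,\bar x(y),(\nu y)S)$; Rep: if $P\xrightarrow{\mu}P'$ then $live(\langle s,n\rangle,\mu,!_{\langle s,n\rangle}P)$; Par: $live(v,\mu,S_0)$, $bn(\mu)\cap fn(S_1)=\emptyset$ imply $live(v,\mu,S_0|S_1)$; Com: $live(v,xy,S_0)$, $live(w,\bar xy,S_1)$ imply $live(v,\tau,S_0|S_1)$ and $live(w,\tau,S_0|S_1)$; Close: $live(v,xy,S_0)$, $live(w,\bar x(y),S_1)$, $y\notin fn(S_0)$ imply $live(v,\tau,(\nu y)(S_0|S_1))$ and $live(w,\tau,(\nu y)(S_0|S_1))$ (together with symmetric versions of Par, Com, Close). $Ll(S)=\{v: live(v,\tau,S)\}$. Computations. A maximal computation from $S$ is either an infinite sequence $S=S_0\xrightarrow{\tau}S_1\xrightarrow{\tau}\cdots$ or a finite one $S=S_0\xrightarrow{\tau}\cdots\xrightarrow{\tau}S_n$ with no $\tau$-transition from $S_n$. It is weak-fair if for every label $v$ and every index $i$ there is an index $j\ge i$ with $v\notin Ll(S_j)$; it is strong-fair if for every label $v$ there is an index $i$ such that $v\notin Ll(S_j)$ for all indices $j\ge i$ (indices range over the states of the computation). *)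

theory Defs
  imports
    "HOL-Combinatorics.Transposition"
    "HOL-Library.Infinite_Typeclass"
    "HOL-Library.Sublist"
    "HOL-Library.Extended_Nat"
begin

text \<open>
  Names are the elements of an arbitrary infinite type. Terms are taken up to alpha-conversion:
  for unlabeled and for labeled terms there is a raw datatype, the alpha-equivalence on it, and
  the quotient type, on which everything else is defined.
\<close>

subsection \<open>Raw unlabeled terms\<close>

text \<open>The grammar is that of observers; processes are the terms without the success prefix.\<close>

datatype 'n rproc =
    RNil
  | RIn 'n 'n "'n rproc"
  | ROut 'n 'n "'n rproc"
  | RSucc "'n rproc"
  | RPar "'n rproc" "'n rproc"
  | RRes 'n "'n rproc"
  | RRep "'n rproc"

primrec rfn :: "'n rproc \<Rightarrow> 'n set" where
  "rfn RNil = {}"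
| "rfn (RIn x y P) = {x} \<union> (rfn P - {y})"
| "rfn (ROut x y P) = {x, y} \<union> rfn P"
| "rfn (RSucc P) = rfn P"
| "rfn (RPar P Q) = rfn P \<union> rfn Q"
| "rfn (RRes x P) = rfn P - {x}"
| "rfn (RRep P) = rfn P"

primrec romega_free :: "'n rproc \<Rightarrow> bool" where
  "romega_free RNil = True"
| "romega_free (RIn x y P) = romega_free P"
| "romega_free (ROut x y P) = romega_free P"
| "romega_free (RSucc P) = False"
| "romega_free (RPar P Q) = (romega_free P \<and> romega_free Q)"
| "romega_free (RRes x P) = romega_free P"
| "romega_free (RRep P) = romega_free P"

text \<open>
  \<open>map_rproc\<close> renames all names, the binding occurrences included; for a transposition of the
  bound name with a name that is not free in the body this is a change of bound name.
\<close>

inductive alpha :: "'n rproc \<Rightarrow> 'n rproc \<Rightarrow> bool" where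
  refl: "alpha P P"
| sym: "alpha P Q \<Longrightarrow> alpha Q P"
| trans: "alpha P Q \<Longrightarrow> alpha Q R \<Longrightarrow> alpha P R"
| In_rename: "z \<notin> rfn P \<Longrightarrow> alpha (RIn x y P) (RIn x z (map_rproc (transpose y z) P))"
| Res_rename: "z \<notin> rfn P \<Longrightarrow> alpha (RRes y P) (RRes z (map_rproc (transpose y z) P))"
| In: "alpha P Q \<Longrightarrow> alpha (RIn x y P) (RIn x y Q)"
| Out: "alpha P Q \<Longrightarrow> alpha (ROut x y P) (ROut x y Q)"
| Succ: "alpha P Q \<Longrightarrow> alpha (RSucc P) (RSucc Q)"
| Par: "alpha P P' \<Longrightarrow> alpha Q Q' \<Longrightarrow> alpha (RPar P Q) (RPar P' Q')"
| Res: "alpha P Q \<Longrightarrow> alpha (RRes x P) (RRes x Q)"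
| Rep: "alpha P Q \<Longrightarrow> alpha (RRep P) (RRep Q)"

definition fresh :: "'n set \<Rightarrow> 'n" where
  "fresh A = (SOME z. z \<notin> A)"

text \<open>
  Capture-avoiding simultaneous substitution. Every binder is renamed to a name chosen from the
  free names alone, so that alpha-equivalent terms have equal images.
\<close>

primrec rsubst :: "('n::infinite \<Rightarrow> 'n) \<Rightarrow> 'n rproc \<Rightarrow> 'n rproc" where
  "rsubst f RNil = RNil"
| "rsubst f (RIn x y P) =
    (let z = fresh (f ` (rfn P - {y})) in RIn (f x) z (rsubst (f(y := z)) P))"
| "rsubst f (ROut x y P) = ROut (f x) (f y) (rsubst f P)"
| "rsubst f (RSucc P) = RSucc (rsubst f P)"
| "rsubst f (RPar P Q) = RPar (rsubst f P) (rsubst f Q)"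
| "rsubst f (RRes y P) =
    (let z = fresh (f ` (rfn P - {y})) in RRes z (rsubst (f(y := z)) P))"
| "rsubst f (RRep P) = RRep (rsubst f P)"

lemma finite_rfn: "finite (rfn P)"
  by (induction P) auto

lemma fresh_notin: "finite A \<Longrightarrow> fresh A \<notin> (A :: 'n::infinite set)"
  unfolding fresh_def by (rule someI_ex) (rule ex_new_if_finite[OF infinite_UNIV])

lemma rfn_map: "inj f \<Longrightarrow> rfn (map_rproc f P) = f ` rfn P"
  by (induction P) (auto simp: inj_image_mem_iff image_set_diff image_Un dest: injD)

lemma romega_free_map: "romega_free (map_rproc f P) = romega_free P"
  by (induction P) auto

lemma transpose_image_fresh: "z \<notin> A \<Longrightarrow> transpose y z ` A - {z} = A - {y}"
  by (auto simp: transpose_def image_iff)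

lemma alpha_rfn: "alpha P Q \<Longrightarrow> rfn P = rfn Q"
  by (induction rule: alpha.induct) (auto simp: rfn_map transpose_image_fresh)

lemma alpha_romega_free: "alpha P Q \<Longrightarrow> romega_free P = romega_free Q"
  by (induction rule: alpha.induct) (auto simp: romega_free_map)

lemma rsubst_cong: "(\<And>x. x \<in> rfn P \<Longrightarrow> f x = g x) \<Longrightarrow> rsubst f P = rsubst g P"
proof (induction P arbitrary: f g)
  case (RIn x y P)
  have *: "f ` (rfn P - {y}) = g ` (rfn P - {y})" using RIn.prems by (auto intro!: image_cong)
  have "rsubst (f(y := z)) P = rsubst (g(y := z)) P" for z
    by (rule RIn.IH) (use RIn.prems in auto)
  then show ?case using RIn.prems by (simp add: * Let_def)
next
  case (RRes y P)
  have *: "f ` (rfn P - {y}) = g ` (rfn P - {y})" using RRes.prems by (auto intro!: image_cong)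
  have "rsubst (f(y := z)) P = rsubst (g(y := z)) P" for z
    by (rule RRes.IH) (use RRes.prems in auto)
  then show ?case using RRes.prems by (simp add: * Let_def)
next
  case (RPar P Q)
  have "rsubst f P = rsubst g P" "rsubst f Q = rsubst g Q"
    by (rule RPar.IH; use RPar.prems in simp)+
  then show ?case by simp
next
  case (ROut x y P)
  have "rsubst f P = rsubst g P"
    by (rule ROut.IH; use ROut.prems in simp)
  then show ?case using ROut.prems by simp
next
  case (RSucc P)
  have "rsubst f P = rsubst g P"
    by (rule RSucc.IH; use RSucc.prems in simp)
  then show ?case by simp
next
  case (RRep P)
  have "rsubst f P = rsubst g P"
    by (rule RRep.IH; use RRep.prems in simp)
  then show ?case by simp
qed simp

lemma fun_upd_comp_inj: "inj p \<Longrightarrow> (f(p y := z)) \<circ> p = (f \<circ> p)(y := z)"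
  by (auto simp: fun_eq_iff dest: injD)

lemma rsubst_map: "inj p \<Longrightarrow> rsubst f (map_rproc p P) = rsubst (f \<circ> p) P"
proof (induction P arbitrary: f)
  case (RIn x y P)
  have "f ` (p ` rfn P - {p y}) = (f \<circ> p) ` (rfn P - {y})"
    using RIn.prems by (auto simp: image_comp dest: injD)
  then show ?case
    by (simp only: rproc.map rsubst.simps Let_def rfn_map[OF RIn.prems] RIn.IH[OF RIn.prems]
        fun_upd_comp_inj[OF RIn.prems])
      (simp only: o_def)
next
  case (RRes y P)
  have "f ` (p ` rfn P - {p y}) = (f \<circ> p) ` (rfn P - {y})"
    using RRes.prems by (auto simp: image_comp dest: injD)
  then show ?case
    by (simp only: rproc.map rsubst.simps Let_def rfn_map[OF RRes.prems] RRes.IH[OF RRes.prems]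
        fun_upd_comp_inj[OF RRes.prems])
qed auto

lemma rsubst_rename:
  assumes "z \<notin> rfn P"
  shows "f ` (rfn (map_rproc (transpose y z) P) - {z}) = f ` (rfn P - {y})"
    and "rsubst (f(z := w)) (map_rproc (transpose y z) P) = rsubst (f(y := w)) P"
proof -
  show "f ` (rfn (map_rproc (transpose y z) P) - {z}) = f ` (rfn P - {y})"
    using assms by (simp add: rfn_map transpose_image_fresh)
  have "rsubst (f(z := w) \<circ> transpose y z) P = rsubst (f(y := w)) P"
    using assms by (intro rsubst_cong) (auto simp: transpose_def)
  then show "rsubst (f(z := w)) (map_rproc (transpose y z) P) = rsubst (f(y := w)) P"
    by (simp add: rsubst_map)
qed

lemma alpha_rsubst: "alpha P Q \<Longrightarrow> rsubst f P = rsubst f Q"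
  by (induction arbitrary: f rule: alpha.induct)
    (simp_all add: rsubst_rename Let_def alpha_rfn)

lemma alpha_RIn_fresh:
  "z \<notin> rfn P \<or> z = y \<Longrightarrow> alpha (RIn x y P) (RIn x z (map_rproc (transpose y z) P))"
  by (auto intro: alpha.In_rename alpha.refl simp: rproc.map_id)

lemma alpha_RRes_fresh:
  "z \<notin> rfn P \<or> z = y \<Longrightarrow> alpha (RRes y P) (RRes z (map_rproc (transpose y z) P))"
  by (auto intro: alpha.Res_rename alpha.refl simp: rproc.map_id)

lemma rsubst_bij: "bij p \<Longrightarrow> alpha (rsubst p P) (map_rproc p P)"
proof (induction P arbitrary: p)
  case (RIn x y P)
  define z where "z = fresh (p ` (rfn P - {y}))"
  have z: "z \<notin> p ` (rfn P - {y})"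
    unfolding z_def by (rule fresh_notin) (simp add: finite_rfn)
  let ?q = "transpose (p y) z \<circ> p"
  have inj: "inj p" using RIn.prems by (simp add: bij_is_inj)
  have "rsubst (p(y := z)) P = rsubst ?q P"
    using z inj by (intro rsubst_cong) (auto simp: transpose_def dest: injD)
  moreover have "alpha (rsubst ?q P) (map_rproc ?q P)"
    by (intro RIn.IH bij_comp RIn.prems bij_transpose)
  ultimately have "alpha (RIn (p x) z (rsubst (p(y := z)) P))
      (RIn (p x) z (map_rproc (transpose (p y) z) (map_rproc p P)))"
    by (simp add: alpha.In rproc.map_comp)
  moreover have "alpha (RIn (p x) (p y) (map_rproc p P))
      (RIn (p x) z (map_rproc (transpose (p y) z) (map_rproc p P)))"
    using z inj by (intro alpha_RIn_fresh) (auto simp: rfn_map)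
  ultimately show ?case
    unfolding rsubst.simps rproc.map Let_def z_def[symmetric]
    by (blast intro: alpha.trans alpha.sym)
next
  case (RRes y P)
  define z where "z = fresh (p ` (rfn P - {y}))"
  have z: "z \<notin> p ` (rfn P - {y})"
    unfolding z_def by (rule fresh_notin) (simp add: finite_rfn)
  let ?q = "transpose (p y) z \<circ> p"
  have inj: "inj p" using RRes.prems by (simp add: bij_is_inj)
  have "rsubst (p(y := z)) P = rsubst ?q P"
    using z inj by (intro rsubst_cong) (auto simp: transpose_def dest: injD)
  moreover have "alpha (rsubst ?q P) (map_rproc ?q P)"
    by (intro RRes.IH bij_comp RRes.prems bij_transpose)
  ultimately have "alpha (RRes z (rsubst (p(y := z)) P))
      (RRes z (map_rproc (transpose (p y) z) (map_rproc p P)))"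
    by (simp add: alpha.Res rproc.map_comp)
  moreover have "alpha (RRes (p y) (map_rproc p P))
      (RRes z (map_rproc (transpose (p y) z) (map_rproc p P)))"
    using z inj by (intro alpha_RRes_fresh) (auto simp: rfn_map)
  ultimately show ?case
    unfolding rsubst.simps rproc.map Let_def z_def[symmetric]
    by (blast intro: alpha.trans alpha.sym)
qed (simp_all add: alpha.refl alpha.Out alpha.Succ alpha.Par alpha.Rep)

lemma rsubst_id: "alpha (rsubst id P) P"
  using rsubst_bij[of id P] by (simp add: rproc.map_id)

lemma alpha_iff_rsubst: "alpha P Q \<longleftrightarrow> rsubst id P = rsubst id Q"
  by (metis alpha_rsubst rsubst_id alpha.sym alpha.trans)

lemma upd_image_fresh: "z \<notin> f ` (A - {y}) \<Longrightarrow> (f(y := z)) ` A - {z} = f ` (A - {y})"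
  by (auto simp: image_iff)

lemma rfn_rsubst: "rfn (rsubst f P) = f ` rfn P"
proof (induction P arbitrary: f)
  case (RIn x y P)
  have "fresh (f ` (rfn P - {y})) \<notin> f ` (rfn P - {y})"
    by (rule fresh_notin) (simp add: finite_rfn)
  from upd_image_fresh[OF this] show ?case
    by (simp only: rsubst.simps rfn.simps Let_def RIn.IH image_Un image_insert image_empty)
next
  case (RRes y P)
  have "fresh (f ` (rfn P - {y})) \<notin> f ` (rfn P - {y})"
    by (rule fresh_notin) (simp add: finite_rfn)
  from upd_image_fresh[OF this] show ?case
    by (simp only: rsubst.simps rfn.simps Let_def RRes.IH image_Un image_insert image_empty)
qed auto

lemma rsubst_rsubst: "rsubst g (rsubst f P) = rsubst (g \<circ> f) P"
proof (induction P arbitrary: f g)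
  case (RIn x y P)
  define z where "z = fresh (f ` (rfn P - {y}))"
  have z: "z \<notin> f ` (rfn P - {y})"
    unfolding z_def by (rule fresh_notin) (simp add: finite_rfn)
  have "rsubst (g(z := w) \<circ> f(y := z)) P = rsubst ((g \<circ> f)(y := w)) P" for w
    using z by (intro rsubst_cong) auto
  then show ?case
    unfolding rsubst.simps Let_def z_def[symmetric] RIn.IH rfn_rsubst
      upd_image_fresh[OF z] image_comp by simp
next
  case (RRes y P)
  define z where "z = fresh (f ` (rfn P - {y}))"
  have z: "z \<notin> f ` (rfn P - {y})"
    unfolding z_def by (rule fresh_notin) (simp add: finite_rfn)
  have "rsubst (g(z := w) \<circ> f(y := z)) P = rsubst ((g \<circ> f)(y := w)) P" for w
    using z by (intro rsubst_cong) auto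
  then show ?case
    unfolding rsubst.simps Let_def z_def[symmetric] RRes.IH rfn_rsubst
      upd_image_fresh[OF z] image_comp by simp
qed auto

lemma rsubst_RIn:
  assumes "y \<notin> f ` (rfn P - {y})"
  shows "alpha (rsubst f (RIn x y P)) (RIn (f x) y (rsubst (f(y := y)) P))"
proof -
  have "rsubst (id(y := w) \<circ> f(y := y)) P = rsubst (f(y := w)) P" for w
    using assms by (intro rsubst_cong) auto
  then show ?thesis
    using rsubst_id[of "RIn (f x) y (rsubst (f(y := y)) P)"] assms
    by (simp only: rsubst.simps Let_def rsubst_rsubst rfn_rsubst image_id id_apply
        upd_image_fresh[OF assms])
qed

lemma rsubst_RRes:
  assumes "y \<notin> f ` (rfn P - {y})"
  shows "alpha (rsubst f (RRes y P)) (RRes y (rsubst (f(y := y)) P))"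
proof -
  have "rsubst (id(y := w) \<circ> f(y := y)) P = rsubst (f(y := w)) P" for w
    using assms by (intro rsubst_cong) auto
  then show ?thesis
    using rsubst_id[of "RRes y (rsubst (f(y := y)) P)"] assms
    by (simp only: rsubst.simps Let_def rsubst_rsubst rfn_rsubst image_id id_apply
        upd_image_fresh[OF assms])
qed

lemma equivp_alpha: "equivp alpha"
  by (intro equivpI reflpI sympI transpI) (blast intro: alpha.refl alpha.sym alpha.trans)+


subsection \<open>Raw labeled terms\<close>

text \<open>In strings, \<open>False\<close> stands for 0 and \<open>True\<close> for 1.\<close>

type_synonym label = "bool list \<times> nat"

text \<open>
  \<open>REmb P\<close> is an unlabeled term used as a labeled one. The labeled term \<open>\<omega>.o\<close> is
  \<open>REmb (RSucc o)\<close>; general \<open>P\<close> are admitted because the transition \<open>\<omega>.o \<rightarrow> o\<close>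
  leads from a labeled term to an unlabeled observer.
\<close>

datatype 'n rlterm =
    RLNil
  | RLIn label 'n 'n "'n rlterm"
  | RLOut label 'n 'n "'n rlterm"
  | RLPar "'n rlterm" "'n rlterm"
  | RLRes 'n "'n rlterm"
  | RLRep label "'n rproc"
  | REmb "'n rproc"

primrec rlfn :: "'n rlterm \<Rightarrow> 'n set" where
  "rlfn RLNil = {}"
| "rlfn (RLIn v x y E) = {x} \<union> (rlfn E - {y})"
| "rlfn (RLOut v x y E) = {x, y} \<union> rlfn E"
| "rlfn (RLPar E F) = rlfn E \<union> rlfn F"
| "rlfn (RLRes x E) = rlfn E - {x}"
| "rlfn (RLRep v P) = rfn P"
| "rlfn (REmb P) = rfn P"

primrec rlomega_free :: "'n rlterm \<Rightarrow> bool" where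
  "rlomega_free RLNil = True"
| "rlomega_free (RLIn v x y E) = rlomega_free E"
| "rlomega_free (RLOut v x y E) = rlomega_free E"
| "rlomega_free (RLPar E F) = (rlomega_free E \<and> rlomega_free F)"
| "rlomega_free (RLRes x E) = rlomega_free E"
| "rlomega_free (RLRep v P) = romega_free P"
| "rlomega_free (REmb P) = False"

primrec rtops :: "'n rlterm \<Rightarrow> label set" where
  "rtops RLNil = {}"
| "rtops (RLIn v x y E) = {v}"
| "rtops (RLOut v x y E) = {v}"
| "rtops (RLPar E F) = rtops E \<union> rtops F"
| "rtops (RLRes x E) = rtops E"
| "rtops (RLRep v P) = {v}"
| "rtops (REmb P) = {}"

primrec rlabel :: "bool list \<Rightarrow> nat \<Rightarrow> 'n rproc \<Rightarrow> 'n rlterm" where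
  "rlabel s n RNil = RLNil"
| "rlabel s n (RIn x y P) = RLIn (s, n) x y (rlabel s (n + 1) P)"
| "rlabel s n (ROut x y P) = RLOut (s, n) x y (rlabel s (n + 1) P)"
| "rlabel s n (RSucc P) = REmb (RSucc P)"
| "rlabel s n (RPar P Q) = RLPar (rlabel (s @ [False]) n P) (rlabel (s @ [True]) n Q)"
| "rlabel s n (RRes x P) = RLRes x (rlabel s n P)"
| "rlabel s n (RRep P) = RLRep (s, n) P"

inductive lalpha :: "'n rlterm \<Rightarrow> 'n rlterm \<Rightarrow> bool" where
  refl: "lalpha E E"
| sym: "lalpha E F \<Longrightarrow> lalpha F E"
| trans: "lalpha E F \<Longrightarrow> lalpha F G \<Longrightarrow> lalpha E G"
| In_rename: "z \<notin> rlfn E \<Longrightarrow> lalpha (RLIn v x y E) (RLIn v x z (map_rlterm (transpose y z) E))"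
| Res_rename: "z \<notin> rlfn E \<Longrightarrow> lalpha (RLRes y E) (RLRes z (map_rlterm (transpose y z) E))"
| In: "lalpha E F \<Longrightarrow> lalpha (RLIn v x y E) (RLIn v x y F)"
| Out: "lalpha E F \<Longrightarrow> lalpha (RLOut v x y E) (RLOut v x y F)"
| Par: "lalpha E E' \<Longrightarrow> lalpha F F' \<Longrightarrow> lalpha (RLPar E F) (RLPar E' F')"
| Res: "lalpha E F \<Longrightarrow> lalpha (RLRes x E) (RLRes x F)"
| Rep: "alpha P Q \<Longrightarrow> lalpha (RLRep v P) (RLRep v Q)"
| Emb: "alpha P Q \<Longrightarrow> lalpha (REmb P) (REmb Q)"

primrec rlsubst :: "('n::infinite \<Rightarrow> 'n) \<Rightarrow> 'n rlterm \<Rightarrow> 'n rlterm" where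
  "rlsubst f RLNil = RLNil"
| "rlsubst f (RLIn v x y E) =
    (let z = fresh (f ` (rlfn E - {y})) in RLIn v (f x) z (rlsubst (f(y := z)) E))"
| "rlsubst f (RLOut v x y E) = RLOut v (f x) (f y) (rlsubst f E)"
| "rlsubst f (RLPar E F) = RLPar (rlsubst f E) (rlsubst f F)"
| "rlsubst f (RLRes y E) =
    (let z = fresh (f ` (rlfn E - {y})) in RLRes z (rlsubst (f(y := z)) E))"
| "rlsubst f (RLRep v P) = RLRep v (rsubst f P)"
| "rlsubst f (REmb P) = REmb (rsubst f P)"

lemma finite_rlfn: "finite (rlfn E)"
  by (induction E) (auto simp: finite_rfn)

lemma rlfn_map: "inj f \<Longrightarrow> rlfn (map_rlterm f E) = f ` rlfn E"
  by (induction E) (auto simp: rfn_map inj_image_mem_iff image_set_diff image_Un dest: injD)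

lemma rlomega_free_map: "rlomega_free (map_rlterm f E) = rlomega_free E"
  by (induction E) (auto simp: romega_free_map)

lemma rtops_map: "rtops (map_rlterm f E) = rtops E"
  by (induction E) auto

lemma rlabel_map: "rlabel s n (map_rproc f P) = map_rlterm f (rlabel s n P)"
  by (induction P arbitrary: s n) auto

lemma rlfn_rlabel: "rlfn (rlabel s n P) = rfn P"
  by (induction P arbitrary: s n) auto

lemma lalpha_rlfn: "lalpha E F \<Longrightarrow> rlfn E = rlfn F"
  by (induction rule: lalpha.induct) (auto simp: rlfn_map transpose_image_fresh alpha_rfn)

lemma lalpha_rlomega_free: "lalpha E F \<Longrightarrow> rlomega_free E = rlomega_free F"
  by (induction rule: lalpha.induct) (auto simp: rlomega_free_map alpha_romega_free)

lemma lalpha_rtops: "lalpha E F \<Longrightarrow> rtops E = rtops F"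
  by (induction rule: lalpha.induct) (auto simp: rtops_map)

lemma alpha_rlabel: "alpha P Q \<Longrightarrow> lalpha (rlabel s n P) (rlabel s n Q)"
proof (induction arbitrary: s n rule: alpha.induct)
  case (sym P Q)
  then show ?case by (simp add: lalpha.sym)
next
  case (trans P Q R)
  then show ?case by (rule_tac lalpha.trans) auto
qed (simp_all add: rlabel_map rlfn_rlabel lalpha.refl lalpha.In_rename lalpha.Res_rename
    lalpha.In lalpha.Out lalpha.Par lalpha.Res lalpha.Rep lalpha.Emb alpha.Succ)

lemma rlsubst_cong: "(\<And>x. x \<in> rlfn E \<Longrightarrow> f x = g x) \<Longrightarrow> rlsubst f E = rlsubst g E"
proof (induction E arbitrary: f g)
  case (RLIn v x y E)
  have *: "f ` (rlfn E - {y}) = g ` (rlfn E - {y})" using RLIn.prems by (auto intro!: image_cong)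
  have "rlsubst (f(y := z)) E = rlsubst (g(y := z)) E" for z
    by (rule RLIn.IH) (use RLIn.prems in auto)
  then show ?case using RLIn.prems by (simp add: * Let_def)
next
  case (RLRes y E)
  have *: "f ` (rlfn E - {y}) = g ` (rlfn E - {y})" using RLRes.prems by (auto intro!: image_cong)
  have "rlsubst (f(y := z)) E = rlsubst (g(y := z)) E" for z
    by (rule RLRes.IH) (use RLRes.prems in auto)
  then show ?case using RLRes.prems by (simp add: * Let_def)
next
  case (RLPar E F)
  have "rlsubst f E = rlsubst g E" "rlsubst f F = rlsubst g F"
    by (rule RLPar.IH; use RLPar.prems in simp)+
  then show ?case by simp
next
  case (RLOut v x y E)
  have "rlsubst f E = rlsubst g E"
    by (rule RLOut.IH; use RLOut.prems in simp)
  then show ?case using RLOut.prems by simp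
next
  case (RLRep v P)
  have "rsubst f P = rsubst g P"
    by (rule rsubst_cong) (use RLRep.prems in simp)
  then show ?case by simp
next
  case (REmb P)
  have "rsubst f P = rsubst g P"
    by (rule rsubst_cong) (use REmb.prems in simp)
  then show ?case by simp
qed simp

lemma rlsubst_map: "inj p \<Longrightarrow> rlsubst f (map_rlterm p E) = rlsubst (f \<circ> p) E"
proof (induction E arbitrary: f)
  case (RLIn v x y E)
  have "f ` (p ` rlfn E - {p y}) = (f \<circ> p) ` (rlfn E - {y})"
    using RLIn.prems by (auto simp: image_comp dest: injD)
  then show ?case
    by (simp only: rlterm.map rlsubst.simps Let_def rlfn_map[OF RLIn.prems] RLIn.IH[OF RLIn.prems]
        fun_upd_comp_inj[OF RLIn.prems])
      (simp only: o_def)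
next
  case (RLRes y E)
  have "f ` (p ` rlfn E - {p y}) = (f \<circ> p) ` (rlfn E - {y})"
    using RLRes.prems by (auto simp: image_comp dest: injD)
  then show ?case
    by (simp only: rlterm.map rlsubst.simps Let_def rlfn_map[OF RLRes.prems] RLRes.IH[OF RLRes.prems]
        fun_upd_comp_inj[OF RLRes.prems])
qed (auto simp: rsubst_map)

lemma rlsubst_rename:
  assumes "z \<notin> rlfn E"
  shows "f ` (rlfn (map_rlterm (transpose y z) E) - {z}) = f ` (rlfn E - {y})"
    and "rlsubst (f(z := w)) (map_rlterm (transpose y z) E) = rlsubst (f(y := w)) E"
proof -
  show "f ` (rlfn (map_rlterm (transpose y z) E) - {z}) = f ` (rlfn E - {y})"
    using assms by (simp add: rlfn_map transpose_image_fresh)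
  have "rlsubst (f(z := w) \<circ> transpose y z) E = rlsubst (f(y := w)) E"
    using assms by (intro rlsubst_cong) (auto simp: transpose_def)
  then show "rlsubst (f(z := w)) (map_rlterm (transpose y z) E) = rlsubst (f(y := w)) E"
    by (simp add: rlsubst_map)
qed

lemma lalpha_rlsubst: "lalpha E F \<Longrightarrow> rlsubst f E = rlsubst f F"
  by (induction arbitrary: f rule: lalpha.induct)
    (simp_all add: rlsubst_rename Let_def lalpha_rlfn alpha_rsubst)

lemma lalpha_RLIn_fresh:
  "z \<notin> rlfn E \<or> z = y \<Longrightarrow> lalpha (RLIn v x y E) (RLIn v x z (map_rlterm (transpose y z) E))"
  by (auto intro: lalpha.In_rename lalpha.refl simp: rlterm.map_id)

lemma lalpha_RLRes_fresh:
  "z \<notin> rlfn E \<or> z = y \<Longrightarrow> lalpha (RLRes y E) (RLRes z (map_rlterm (transpose y z) E))"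
  by (auto intro: lalpha.Res_rename lalpha.refl simp: rlterm.map_id)

lemma rlsubst_bij: "bij p \<Longrightarrow> lalpha (rlsubst p E) (map_rlterm p E)"
proof (induction E arbitrary: p)
  case (RLIn v x y E)
  define z where "z = fresh (p ` (rlfn E - {y}))"
  have z: "z \<notin> p ` (rlfn E - {y})"
    unfolding z_def by (rule fresh_notin) (simp add: finite_rlfn)
  let ?q = "transpose (p y) z \<circ> p"
  have inj: "inj p" using RLIn.prems by (simp add: bij_is_inj)
  have "rlsubst (p(y := z)) E = rlsubst ?q E"
    using z inj by (intro rlsubst_cong) (auto simp: transpose_def dest: injD)
  moreover have "lalpha (rlsubst ?q E) (map_rlterm ?q E)"
    by (intro RLIn.IH bij_comp RLIn.prems bij_transpose)
  ultimately have "lalpha (RLIn v (p x) z (rlsubst (p(y := z)) E))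
      (RLIn v (p x) z (map_rlterm (transpose (p y) z) (map_rlterm p E)))"
    by (simp add: lalpha.In rlterm.map_comp)
  moreover have "lalpha (RLIn v (p x) (p y) (map_rlterm p E))
      (RLIn v (p x) z (map_rlterm (transpose (p y) z) (map_rlterm p E)))"
    using z inj by (intro lalpha_RLIn_fresh) (auto simp: rlfn_map)
  ultimately show ?case
    unfolding rlsubst.simps rlterm.map Let_def z_def[symmetric]
    by (blast intro: lalpha.trans lalpha.sym)
next
  case (RLRes y E)
  define z where "z = fresh (p ` (rlfn E - {y}))"
  have z: "z \<notin> p ` (rlfn E - {y})"
    unfolding z_def by (rule fresh_notin) (simp add: finite_rlfn)
  let ?q = "transpose (p y) z \<circ> p"
  have inj: "inj p" using RLRes.prems by (simp add: bij_is_inj)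
  have "rlsubst (p(y := z)) E = rlsubst ?q E"
    using z inj by (intro rlsubst_cong) (auto simp: transpose_def dest: injD)
  moreover have "lalpha (rlsubst ?q E) (map_rlterm ?q E)"
    by (intro RLRes.IH bij_comp RLRes.prems bij_transpose)
  ultimately have "lalpha (RLRes z (rlsubst (p(y := z)) E))
      (RLRes z (map_rlterm (transpose (p y) z) (map_rlterm p E)))"
    by (simp add: lalpha.Res rlterm.map_comp)
  moreover have "lalpha (RLRes (p y) (map_rlterm p E))
      (RLRes z (map_rlterm (transpose (p y) z) (map_rlterm p E)))"
    using z inj by (intro lalpha_RLRes_fresh) (auto simp: rlfn_map)
  ultimately show ?case
    unfolding rlsubst.simps rlterm.map Let_def z_def[symmetric]
    by (blast intro: lalpha.trans lalpha.sym)
qed (simp_all add: lalpha.refl lalpha.Out lalpha.Par lalpha.Rep lalpha.Emb rsubst_bij)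

lemma rlsubst_id: "lalpha (rlsubst id E) E"
  using rlsubst_bij[of id E] by (simp add: rlterm.map_id)

lemma rlfn_rlsubst: "rlfn (rlsubst f E) = f ` rlfn E"
proof (induction E arbitrary: f)
  case (RLIn v x y E)
  have "fresh (f ` (rlfn E - {y})) \<notin> f ` (rlfn E - {y})"
    by (rule fresh_notin) (simp add: finite_rlfn)
  from upd_image_fresh[OF this] show ?case
    by (simp only: rlsubst.simps rlfn.simps Let_def RLIn.IH image_Un image_insert image_empty)
next
  case (RLRes y E)
  have "fresh (f ` (rlfn E - {y})) \<notin> f ` (rlfn E - {y})"
    by (rule fresh_notin) (simp add: finite_rlfn)
  from upd_image_fresh[OF this] show ?case
    by (simp only: rlsubst.simps rlfn.simps Let_def RLRes.IH image_Un image_insert image_empty)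
qed (auto simp: rfn_rsubst)

lemma rlsubst_rlsubst: "rlsubst g (rlsubst f E) = rlsubst (g \<circ> f) E"
proof (induction E arbitrary: f g)
  case (RLIn v x y E)
  define z where "z = fresh (f ` (rlfn E - {y}))"
  have z: "z \<notin> f ` (rlfn E - {y})"
    unfolding z_def by (rule fresh_notin) (simp add: finite_rlfn)
  have "rlsubst (g(z := w) \<circ> f(y := z)) E = rlsubst ((g \<circ> f)(y := w)) E" for w
    using z by (intro rlsubst_cong) auto
  then show ?case
    unfolding rlsubst.simps Let_def z_def[symmetric] RLIn.IH rlfn_rlsubst
      upd_image_fresh[OF z] image_comp by simp
next
  case (RLRes y E)
  define z where "z = fresh (f ` (rlfn E - {y}))"
  have z: "z \<notin> f ` (rlfn E - {y})"
    unfolding z_def by (rule fresh_notin) (simp add: finite_rlfn)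
  have "rlsubst (g(z := w) \<circ> f(y := z)) E = rlsubst ((g \<circ> f)(y := w)) E" for w
    using z by (intro rlsubst_cong) auto
  then show ?case
    unfolding rlsubst.simps Let_def z_def[symmetric] RLRes.IH rlfn_rlsubst
      upd_image_fresh[OF z] image_comp by simp
qed (auto simp: rsubst_rsubst)

lemma rlsubst_RLIn:
  assumes "y \<notin> f ` (rlfn E - {y})"
  shows "lalpha (rlsubst f (RLIn v x y E)) (RLIn v (f x) y (rlsubst (f(y := y)) E))"
proof -
  have "rlsubst (id(y := w) \<circ> f(y := y)) E = rlsubst (f(y := w)) E" for w
    using assms by (intro rlsubst_cong) auto
  then show ?thesis
    using rlsubst_id[of "RLIn v (f x) y (rlsubst (f(y := y)) E)"] assms
    by (simp only: rlsubst.simps Let_def rlsubst_rlsubst rlfn_rlsubst image_id id_apply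
        upd_image_fresh[OF assms])
qed

lemma rlsubst_RLRes:
  assumes "y \<notin> f ` (rlfn E - {y})"
  shows "lalpha (rlsubst f (RLRes y E)) (RLRes y (rlsubst (f(y := y)) E))"
proof -
  have "rlsubst (id(y := w) \<circ> f(y := y)) E = rlsubst (f(y := w)) E" for w
    using assms by (intro rlsubst_cong) auto
  then show ?thesis
    using rlsubst_id[of "RLRes y (rlsubst (f(y := y)) E)"] assms
    by (simp only: rlsubst.simps Let_def rlsubst_rlsubst rlfn_rlsubst image_id id_apply
        upd_image_fresh[OF assms])
qed

lemma equivp_lalpha: "equivp lalpha"
  by (intro equivpI reflpI sympI transpI) (blast intro: lalpha.refl lalpha.sym lalpha.trans)+


subsection \<open>Unlabeled terms up to alpha-conversion\<close>

quotient_type 'n proc = "'n rproc" / alpha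
  by (rule equivp_alpha)

lift_definition PNil :: "'n proc" is RNil .
lift_definition PIn :: "'n \<Rightarrow> 'n \<Rightarrow> 'n proc \<Rightarrow> 'n proc" is RIn by (rule alpha.In)
lift_definition POut :: "'n \<Rightarrow> 'n \<Rightarrow> 'n proc \<Rightarrow> 'n proc" is ROut by (rule alpha.Out)
lift_definition PSucc :: "'n proc \<Rightarrow> 'n proc" is RSucc by (rule alpha.Succ)
lift_definition PPar :: "'n proc \<Rightarrow> 'n proc \<Rightarrow> 'n proc" is RPar by (rule alpha.Par)
lift_definition PRes :: "'n \<Rightarrow> 'n proc \<Rightarrow> 'n proc" is RRes by (rule alpha.Res)
lift_definition PRep :: "'n proc \<Rightarrow> 'n proc" is RRep by (rule alpha.Rep)

lift_definition fn :: "'n proc \<Rightarrow> 'n set" is rfn by (rule alpha_rfn)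

lift_definition omega_free :: "'n proc \<Rightarrow> bool" is romega_free by (rule alpha_romega_free)

lift_definition ssubst :: "('n::infinite \<Rightarrow> 'n) \<Rightarrow> 'n proc \<Rightarrow> 'n proc" is rsubst
  using alpha_rsubst alpha.refl by metis

text \<open>\<open>subst z y P\<close> is \<open>P{z/y}\<close>.\<close>

definition subst :: "'n::infinite \<Rightarrow> 'n \<Rightarrow> 'n proc \<Rightarrow> 'n proc" where
  "subst z y P = ssubst (id(y := z)) P"

lemma fn_simps [simp]:
  "fn PNil = {}" "fn (PIn x y P) = {x} \<union> (fn P - {y})" "fn (POut x y P) = {x, y} \<union> fn P"
  "fn (PSucc P) = fn P" "fn (PPar P Q) = fn P \<union> fn Q" "fn (PRes y P) = fn P - {y}"
  "fn (PRep P) = fn P"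
  by (transfer; simp)+

lemma omega_free_simps [simp]:
  "omega_free PNil" "omega_free (PIn x y P) = omega_free P" "omega_free (POut x y P) = omega_free P"
  "\<not> omega_free (PSucc P)" "omega_free (PPar P Q) = (omega_free P \<and> omega_free Q)"
  "omega_free (PRes y P) = omega_free P" "omega_free (PRep P) = omega_free P"
  by (transfer; simp)+

lemma proc_exhaust:
  obtains "P = PNil" | x y Q where "P = PIn x y Q" | x y Q where "P = POut x y Q"
    | Q where "P = PSucc Q" | Q R where "P = PPar Q R" | y Q where "P = PRes y Q"
    | Q where "P = PRep Q"
proof -
  obtain R where P: "P = abs_proc R" by (metis Quotient3_abs_rep[OF Quotient3_proc])
  show thesis
    by (cases R)
      (use P that in \<open>metis PNil.abs_eq PIn.abs_eq POut.abs_eq PSucc.abs_eq PPar.abs_eq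
        PRes.abs_eq PRep.abs_eq\<close>)+
qed

lemma subst_simps [simp]:
  "subst z w PNil = PNil"
  "subst z w (POut x y P) = POut ((id(w := z)) x) ((id(w := z)) y) (subst z w P)"
  "subst z w (PSucc P) = PSucc (subst z w P)"
  "subst z w (PPar P Q) = PPar (subst z w P) (subst z w Q)"
  "subst z w (PRep P) = PRep (subst z w P)"
  unfolding subst_def by (transfer; auto intro: alpha.refl)+

lemma subst_PIn:
  "y \<noteq> w \<Longrightarrow> y \<noteq> z \<Longrightarrow> subst z w (PIn x y P) = PIn ((id(w := z)) x) y (subst z w P)"
  unfolding subst_def
proof (transfer, goal_cases)
  case (1 y w z x P)
  then have "(id(w := z))(y := y) = id(w := z)" by auto
  moreover have "y \<notin> (id(w := z)) ` (rfn P - {y})" using 1 by auto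
  ultimately show ?case using rsubst_RIn[of y "id(w := z)" P x] by metis
qed

lemma subst_PRes:
  "y \<noteq> w \<Longrightarrow> y \<noteq> z \<Longrightarrow> subst z w (PRes y P) = PRes y (subst z w P)"
  unfolding subst_def
proof (transfer, goal_cases)
  case (1 y w z P)
  then have "(id(w := z))(y := y) = id(w := z)" by auto
  moreover have "y \<notin> (id(w := z)) ` (rfn P - {y})" using 1 by auto
  ultimately show ?case using rsubst_RRes[of y "id(w := z)" P] by metis
qed

lemma subst_fresh: "w \<notin> fn P \<Longrightarrow> subst z w P = P"
  unfolding subst_def
proof (transfer, goal_cases)
  case (1 w P z)
  then have "rsubst (id(w := z)) P = rsubst id P" by (intro rsubst_cong) auto
  then show ?case using rsubst_id[of P] by simp
qed

lemma PIn_alpha: "z \<notin> fn P \<Longrightarrow> PIn x y P = PIn x z (subst z y P)"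
  unfolding subst_def
proof (transfer, goal_cases)
  case (1 z P x y)
  have "rsubst (id(y := z)) P = rsubst id (map_rproc (transpose y z) P)"
    using rsubst_rename(2)[OF 1, of id z y] by (simp add: fun_upd_idem)
  then show ?case
    using 1 rsubst_id alpha.In_rename alpha.In alpha.sym alpha.trans by metis
qed

lemma PRes_alpha: "z \<notin> fn P \<Longrightarrow> PRes y P = PRes z (subst z y P)"
  unfolding subst_def
proof (transfer, goal_cases)
  case (1 z P y)
  have "rsubst (id(y := z)) P = rsubst id (map_rproc (transpose y z) P)"
    using rsubst_rename(2)[OF 1, of id z y] by (simp add: fun_upd_idem)
  then show ?case
    using 1 rsubst_id alpha.Res_rename alpha.Res alpha.sym alpha.trans by metis
qed


subsection \<open>Labeled terms up to alpha-conversion\<close>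

quotient_type 'n lterm = "'n rlterm" / lalpha
  by (rule equivp_lalpha)

lift_definition LNil :: "'n lterm" is RLNil .
lift_definition LIn :: "label \<Rightarrow> 'n \<Rightarrow> 'n \<Rightarrow> 'n lterm \<Rightarrow> 'n lterm" is RLIn by (rule lalpha.In)
lift_definition LOut :: "label \<Rightarrow> 'n \<Rightarrow> 'n \<Rightarrow> 'n lterm \<Rightarrow> 'n lterm" is RLOut by (rule lalpha.Out)
lift_definition LPar :: "'n lterm \<Rightarrow> 'n lterm \<Rightarrow> 'n lterm" is RLPar by (rule lalpha.Par)
lift_definition LRes :: "'n \<Rightarrow> 'n lterm \<Rightarrow> 'n lterm" is RLRes by (rule lalpha.Res)
lift_definition LRep :: "label \<Rightarrow> 'n proc \<Rightarrow> 'n lterm" is RLRep by (rule lalpha.Rep)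
lift_definition Emb :: "'n proc \<Rightarrow> 'n lterm" is REmb by (rule lalpha.Emb)

abbreviation LSucc :: "'n proc \<Rightarrow> 'n lterm" where
  "LSucc P \<equiv> Emb (PSucc P)"

lift_definition lfn :: "'n lterm \<Rightarrow> 'n set" is rlfn by (rule lalpha_rlfn)

lift_definition lomega_free :: "'n lterm \<Rightarrow> bool" is rlomega_free by (rule lalpha_rlomega_free)

lift_definition tops :: "'n lterm \<Rightarrow> label set" is rtops by (rule lalpha_rtops)

lift_definition labeling :: "bool list \<Rightarrow> nat \<Rightarrow> 'n proc \<Rightarrow> 'n lterm" is rlabel
  by (rule alpha_rlabel)

lift_definition lssubst :: "('n::infinite \<Rightarrow> 'n) \<Rightarrow> 'n lterm \<Rightarrow> 'n lterm" is rlsubst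
  using lalpha_rlsubst lalpha.refl by metis

definition lsubst :: "'n::infinite \<Rightarrow> 'n \<Rightarrow> 'n lterm \<Rightarrow> 'n lterm" where
  "lsubst z y E = lssubst (id(y := z)) E"

lemma lfn_simps [simp]:
  "lfn LNil = {}" "lfn (LIn v x y E) = {x} \<union> (lfn E - {y})" "lfn (LOut v x y E) = {x, y} \<union> lfn E"
  "lfn (LPar E F) = lfn E \<union> lfn F" "lfn (LRes y E) = lfn E - {y}"
  "lfn (LRep v P) = fn P" "lfn (Emb P) = fn P"
  by (transfer; simp)+

lemma lomega_free_simps [simp]:
  "lomega_free LNil" "lomega_free (LIn v x y E) = lomega_free E"
  "lomega_free (LOut v x y E) = lomega_free E"
  "lomega_free (LPar E F) = (lomega_free E \<and> lomega_free F)"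
  "lomega_free (LRes y E) = lomega_free E" "lomega_free (LRep v P) = omega_free P"
  "\<not> lomega_free (Emb P)"
  by (transfer; simp)+

lemma tops_simps [simp]:
  "tops LNil = {}" "tops (LIn v x y E) = {v}" "tops (LOut v x y E) = {v}"
  "tops (LPar E F) = tops E \<union> tops F" "tops (LRes y E) = tops E"
  "tops (LRep v P) = {v}" "tops (Emb P) = {}"
  by (transfer; simp)+

lemma labeling_simps [simp]:
  "labeling s n PNil = LNil"
  "labeling s n (PIn x y P) = LIn (s, n) x y (labeling s (n + 1) P)"
  "labeling s n (POut x y P) = LOut (s, n) x y (labeling s (n + 1) P)"
  "labeling s n (PSucc P) = LSucc P"
  "labeling s n (PPar P Q) = LPar (labeling (s @ [False]) n P) (labeling (s @ [True]) n Q)"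
  "labeling s n (PRes y P) = LRes y (labeling s n P)"
  "labeling s n (PRep P) = LRep (s, n) P"
  by (transfer; auto intro: lalpha.refl)+

lemma lsubst_simps [simp]:
  "lsubst z w LNil = LNil"
  "lsubst z w (LOut v x y E) = LOut v ((id(w := z)) x) ((id(w := z)) y) (lsubst z w E)"
  "lsubst z w (LPar E F) = LPar (lsubst z w E) (lsubst z w F)"
  "lsubst z w (LRep v P) = LRep v (subst z w P)"
  "lsubst z w (Emb P) = Emb (subst z w P)"
  unfolding lsubst_def subst_def by (transfer; auto intro: lalpha.refl)+

lemma lsubst_LIn:
  "y \<noteq> w \<Longrightarrow> y \<noteq> z \<Longrightarrow> lsubst z w (LIn v x y E) = LIn v ((id(w := z)) x) y (lsubst z w E)"
  unfolding lsubst_def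
proof (transfer, goal_cases)
  case (1 y w z v x E)
  then have "(id(w := z))(y := y) = id(w := z)" by auto
  moreover have "y \<notin> (id(w := z)) ` (rlfn E - {y})" using 1 by auto
  ultimately show ?case using rlsubst_RLIn[of y "id(w := z)" E v x] by metis
qed

lemma lsubst_LRes:
  "y \<noteq> w \<Longrightarrow> y \<noteq> z \<Longrightarrow> lsubst z w (LRes y E) = LRes y (lsubst z w E)"
  unfolding lsubst_def
proof (transfer, goal_cases)
  case (1 y w z E)
  then have "(id(w := z))(y := y) = id(w := z)" by auto
  moreover have "y \<notin> (id(w := z)) ` (rlfn E - {y})" using 1 by auto
  ultimately show ?case using rlsubst_RLRes[of y "id(w := z)" E] by metis
qed

lemma lsubst_fresh: "w \<notin> lfn E \<Longrightarrow> lsubst z w E = E"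
  unfolding lsubst_def
proof (transfer, goal_cases)
  case (1 w E z)
  then have "rlsubst (id(w := z)) E = rlsubst id E" by (intro rlsubst_cong) auto
  then show ?case using rlsubst_id[of E] by simp
qed

lemma LIn_alpha: "z \<notin> lfn E \<Longrightarrow> LIn v x y E = LIn v x z (lsubst z y E)"
  unfolding lsubst_def
proof (transfer, goal_cases)
  case (1 z E v x y)
  have "rlsubst (id(y := z)) E = rlsubst id (map_rlterm (transpose y z) E)"
    using rlsubst_rename(2)[OF 1, of id z y] by (simp add: fun_upd_idem)
  then show ?case
    using 1 rlsubst_id lalpha.In_rename lalpha.In lalpha.sym lalpha.trans by metis
qed

lemma LRes_alpha: "z \<notin> lfn E \<Longrightarrow> LRes y E = LRes z (lsubst z y E)"
  unfolding lsubst_def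
proof (transfer, goal_cases)
  case (1 z E y)
  have "rlsubst (id(y := z)) E = rlsubst id (map_rlterm (transpose y z) E)"
    using rlsubst_rename(2)[OF 1, of id z y] by (simp add: fun_upd_idem)
  then show ?case
    using 1 rlsubst_id lalpha.Res_rename lalpha.Res lalpha.sym lalpha.trans by metis
qed


subsection \<open>Transitions\<close>

text \<open>
  \<open>AIn x y\<close>, \<open>AOut x y\<close>, \<open>ABOut x y\<close> are the input of \<open>y\<close> on \<open>x\<close>, the free output and the
  bound output of \<open>y\<close> on \<open>x\<close>.
\<close>

datatype 'n act = AIn 'n 'n | AOut 'n 'n | ABOut 'n 'n | ATau | ASucc

fun afn :: "'n act \<Rightarrow> 'n set" where
  "afn (AIn x y) = {x, y}"
| "afn (AOut x y) = {x, y}"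
| "afn (ABOut x y) = {x}"
| "afn ATau = {}"
| "afn ASucc = {}"

fun abn :: "'n act \<Rightarrow> 'n set" where
  "abn (ABOut x y) = {y}"
| "abn _ = {}"

definition an :: "'n act \<Rightarrow> 'n set" where
  "an \<mu> = afn \<mu> \<union> abn \<mu>"

inductive step :: "'n::infinite proc \<Rightarrow> 'n act \<Rightarrow> 'n proc \<Rightarrow> bool" where
  Input: "step (PIn x y P) (AIn x z) (subst z y P)"
| Output: "step (POut x y P) (AOut x y) P"
| Succ: "step (PSucc P) ASucc P"
| Open: "step P (AOut x y) P' \<Longrightarrow> x \<noteq> y \<Longrightarrow> step (PRes y P) (ABOut x y) P'"
| Res: "step P \<mu> P' \<Longrightarrow> y \<notin> an \<mu> \<Longrightarrow> step (PRes y P) \<mu> (PRes y P')"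
| ParL: "step P \<mu> P' \<Longrightarrow> abn \<mu> \<inter> fn Q = {} \<Longrightarrow> step (PPar P Q) \<mu> (PPar P' Q)"
| ParR: "step Q \<mu> Q' \<Longrightarrow> abn \<mu> \<inter> fn P = {} \<Longrightarrow> step (PPar P Q) \<mu> (PPar P Q')"
| ComL: "step P (AIn x y) P' \<Longrightarrow> step Q (AOut x y) Q' \<Longrightarrow> step (PPar P Q) ATau (PPar P' Q')"
| ComR: "step P (AOut x y) P' \<Longrightarrow> step Q (AIn x y) Q' \<Longrightarrow> step (PPar P Q) ATau (PPar P' Q')"
| CloseL: "step P (AIn x y) P' \<Longrightarrow> step Q (ABOut x y) Q' \<Longrightarrow> y \<notin> fn P \<Longrightarrow>
    step (PPar P Q) ATau (PRes y (PPar P' Q'))"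
| CloseR: "step P (ABOut x y) P' \<Longrightarrow> step Q (AIn x y) Q' \<Longrightarrow> y \<notin> fn Q \<Longrightarrow>
    step (PPar P Q) ATau (PRes y (PPar P' Q'))"
| Rep: "step P \<mu> P' \<Longrightarrow> step (PRep P) \<mu> (PPar P' (PRep P))"

text \<open>The rule \<open>Emb\<close> specializes to \<open>\<omega>.o \<rightarrow> o\<close> for \<open>LSucc\<close>.\<close>

inductive lstep :: "'n::infinite lterm \<Rightarrow> 'n act \<Rightarrow> 'n lterm \<Rightarrow> bool" where
  Input: "lstep (LIn v x y E) (AIn x z) (lsubst z y E)"
| Output: "lstep (LOut v x y E) (AOut x y) E"
| Emb: "step P \<mu> P' \<Longrightarrow> lstep (Emb P) \<mu> (Emb P')"
| Open: "lstep E (AOut x y) E' \<Longrightarrow> x \<noteq> y \<Longrightarrow> lstep (LRes y E) (ABOut x y) E'"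
| Res: "lstep E \<mu> E' \<Longrightarrow> y \<notin> an \<mu> \<Longrightarrow> lstep (LRes y E) \<mu> (LRes y E')"
| ParL: "lstep E \<mu> E' \<Longrightarrow> abn \<mu> \<inter> lfn F = {} \<Longrightarrow> lstep (LPar E F) \<mu> (LPar E' F)"
| ParR: "lstep F \<mu> F' \<Longrightarrow> abn \<mu> \<inter> lfn E = {} \<Longrightarrow> lstep (LPar E F) \<mu> (LPar E F')"
| ComL: "lstep E (AIn x y) E' \<Longrightarrow> lstep F (AOut x y) F' \<Longrightarrow> lstep (LPar E F) ATau (LPar E' F')"
| ComR: "lstep E (AOut x y) E' \<Longrightarrow> lstep F (AIn x y) F' \<Longrightarrow> lstep (LPar E F) ATau (LPar E' F')"
| CloseL: "lstep E (AIn x y) E' \<Longrightarrow> lstep F (ABOut x y) F' \<Longrightarrow> y \<notin> lfn E \<Longrightarrow>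
    lstep (LPar E F) ATau (LRes y (LPar E' F'))"
| CloseR: "lstep E (ABOut x y) E' \<Longrightarrow> lstep F (AIn x y) F' \<Longrightarrow> y \<notin> lfn F \<Longrightarrow>
    lstep (LPar E F) ATau (LRes y (LPar E' F'))"
| Rep: "step P \<mu> P' \<Longrightarrow>
    lstep (LRep (s, n) P) \<mu> (LPar (labeling (s @ [False]) (n + 1) P') (LRep (s @ [True], n + 1) P))"

lemma lstep_LSucc: "lstep (LSucc P) ASucc (Emb P)"
  by (intro lstep.Emb step.Succ)


subsection \<open>Labeled experiments\<close>

definition unrelated :: "label set \<Rightarrow> label set \<Rightarrow> bool" where
  "unrelated A B \<longleftrightarrow> (\<forall>(s, n)\<in>A. \<forall>(t, m)\<in>B. \<not> prefix s t \<and> \<not> prefix t s)"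

inductive wf_lterm :: "'n lterm \<Rightarrow> bool" where
  Nil: "wf_lterm LNil"
| Succ: "wf_lterm (LSucc P)"
| In: "wf_lterm (labeling s n (PIn x y P))"
| Out: "wf_lterm (labeling s n (POut x y P))"
| Par: "wf_lterm E \<Longrightarrow> wf_lterm F \<Longrightarrow> unrelated (tops E) (tops F) \<Longrightarrow> wf_lterm (LPar E F)"
| Res: "wf_lterm E \<Longrightarrow> wf_lterm (LRes x E)"
| Rep: "wf_lterm (LRep (s, n) P)"

definition labeled_processes :: "'n lterm set" where
  "labeled_processes = {E. wf_lterm E \<and> lomega_free E}"

definition labeled_observers :: "'n lterm set" where
  "labeled_observers = {E. wf_lterm E}"

text \<open>The labels of the two components of an experiment are not required to be unrelated.\<close>

definition labeled_experiments :: "'n lterm set" where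
  "labeled_experiments = {LPar E R | E R. E \<in> labeled_processes \<and> R \<in> labeled_observers}"


subsection \<open>Live labels\<close>

text \<open>
  The conclusions of the four \<open>Close\<close> rules carry the restriction of \<open>y\<close>, whereas the source of
  the corresponding transition is \<open>LPar S T\<close> without it.
\<close>

inductive live :: "label \<Rightarrow> 'n::infinite act \<Rightarrow> 'n lterm \<Rightarrow> bool" where
  Input: "live v (AIn x z) (LIn v x y S)"
| Output: "live v (AOut x z) (LOut v x z S)"
| Res: "live v \<mu> S \<Longrightarrow> y \<notin> an \<mu> \<Longrightarrow> live v \<mu> (LRes y S)"
| Open: "live v (AOut x y) S \<Longrightarrow> x \<noteq> y \<Longrightarrow> live v (ABOut x y) (LRes y S)"
| Rep: "step P \<mu> P' \<Longrightarrow> live v \<mu> (LRep v P)"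
| ParL: "live v \<mu> S \<Longrightarrow> abn \<mu> \<inter> lfn T = {} \<Longrightarrow> live v \<mu> (LPar S T)"
| ParR: "live v \<mu> T \<Longrightarrow> abn \<mu> \<inter> lfn S = {} \<Longrightarrow> live v \<mu> (LPar S T)"
| ComL_in: "live v (AIn x y) S \<Longrightarrow> live w (AOut x y) T \<Longrightarrow> live v ATau (LPar S T)"
| ComL_out: "live v (AIn x y) S \<Longrightarrow> live w (AOut x y) T \<Longrightarrow> live w ATau (LPar S T)"
| ComR_in: "live v (AIn x y) T \<Longrightarrow> live w (AOut x y) S \<Longrightarrow> live v ATau (LPar S T)"
| ComR_out: "live v (AIn x y) T \<Longrightarrow> live w (AOut x y) S \<Longrightarrow> live w ATau (LPar S T)"
| CloseL_in: "live v (AIn x y) S \<Longrightarrow> live w (ABOut x y) T \<Longrightarrow> y \<notin> lfn S \<Longrightarrow>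
    live v ATau (LRes y (LPar S T))"
| CloseL_out: "live v (AIn x y) S \<Longrightarrow> live w (ABOut x y) T \<Longrightarrow> y \<notin> lfn S \<Longrightarrow>
    live w ATau (LRes y (LPar S T))"
| CloseR_in: "live v (AIn x y) T \<Longrightarrow> live w (ABOut x y) S \<Longrightarrow> y \<notin> lfn T \<Longrightarrow>
    live v ATau (LRes y (LPar S T))"
| CloseR_out: "live v (AIn x y) T \<Longrightarrow> live w (ABOut x y) S \<Longrightarrow> y \<notin> lfn T \<Longrightarrow>
    live w ATau (LRes y (LPar S T))"

definition live_labels :: "'n::infinite lterm \<Rightarrow> label set" where
  "live_labels S = {v. live v ATau S}"


subsection \<open>Computations and fairness\<close>

text \<open>
  A computation is a pair of the index \<open>N\<close> of its last state (\<open>\<infinity>\<close> for an infinite one) and a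
  function whose values at the indices up to \<open>N\<close> are the states.
\<close>

definition maximal_computation :: "'n::infinite lterm \<Rightarrow> enat \<Rightarrow> (nat \<Rightarrow> 'n lterm) \<Rightarrow> bool" where
  "maximal_computation S N c \<longleftrightarrow>
    c 0 = S \<and>
    (\<forall>i. enat i < N \<longrightarrow> lstep (c i) ATau (c (Suc i))) \<and>
    (\<forall>n. N = enat n \<longrightarrow> (\<nexists>T. lstep (c n) ATau T))"

definition weak_fair :: "enat \<Rightarrow> (nat \<Rightarrow> 'n::infinite lterm) \<Rightarrow> bool" where
  "weak_fair N c \<longleftrightarrow>
    (\<forall>v i. enat i \<le> N \<longrightarrow> (\<exists>j\<ge>i. enat j \<le> N \<and> v \<notin> live_labels (c j)))"

definition strong_fair :: "enat \<Rightarrow> (nat \<Rightarrow> 'n::infinite lterm) \<Rightarrow> bool" where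
  "strong_fair N c \<longleftrightarrow>
    (\<forall>v. \<exists>i. enat i \<le> N \<and> (\<forall>j\<ge>i. enat j \<le> N \<longrightarrow> v \<notin> live_labels (c j)))"

end

theory Submission
  imports Defs
begin

text \<open>
  The budget of a label \<open>v\<close> in a term bounds how often \<open>v\<close> can still be consumed. A replication
  labeled \<open>u\<close> contributes at most 1, because unfolding it produces only labels that extend \<open>u\<close>, and
  the two parts of the unfolding extend its string by different bits. No transition increases a
  budget, and a live label admits a transition that decreases its own. The computation which
  always consumes the live label that comes first in a fixed enumeration of all labels is therefore
  strong-fair: while \<open>v\<close> is live, the sum of the budgets of the finitely many labels up to \<open>v\<close>
  drops at every step.

  For the separation, let a message on \<open>a\<close> and a pair synchronizing on \<open>b\<close> alternate, both driven by
  \<open>!a(x).(b\<langle>a\<rangle> | b(x).a\<langle>a\<rangle>)\<close>. A further input on \<open>a\<close> is then live at every other state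
  but may be ignored forever.
\<close>

subsection \<open>The budget of a label\<close>

text \<open>Occurrences are counted with multiplicity, because the two components of an experiment
  may share labels. A replication counts for every label that its unfoldings can generate, its own
  included. Embedded observers carry no labels.\<close>

primrec rbudget :: "label \<Rightarrow> 'n rlterm \<Rightarrow> nat" where
  "rbudget v RLNil = 0"
| "rbudget v (RLIn u x y E) = of_bool (u = v) + rbudget v E"
| "rbudget v (RLOut u x y E) = of_bool (u = v) + rbudget v E"
| "rbudget v (RLPar E F) = rbudget v E + rbudget v F"
| "rbudget v (RLRes x E) = rbudget v E"
| "rbudget v (RLRep u P) = of_bool (prefix (fst u) (fst v) \<and> snd u \<le> snd v)"
| "rbudget v (REmb P) = 0"

lemma rbudget_map: "rbudget v (map_rlterm f E) = rbudget v E"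
  by (induction E) auto

lemma rbudget_rlsubst: "rbudget v (rlsubst f E) = rbudget v E"
  by (induction E arbitrary: f) (auto simp: Let_def)

lemma lalpha_rbudget: "lalpha E F \<Longrightarrow> rbudget v E = rbudget v F"
  by (induction rule: lalpha.induct) (auto simp: rbudget_map)

text \<open>No string extends both \<open>s @ [False]\<close> and \<open>s @ [True]\<close>, so at
  most one summand is 1.\<close>

lemma of_bool_prefix_split:
  "of_bool (prefix (s @ [False]) t \<and> p) + of_bool (prefix (s @ [True]) t \<and> p)
    \<le> (of_bool (prefix s t \<and> p) :: nat)"
  by (auto simp: prefix_def)

text \<open>Labeling never repeats a label: prefixes raise the counter, and parallel branches
  diverge in their strings.\<close>

lemma rbudget_rlabel: "rbudget v (rlabel s n P) \<le> of_bool (prefix s (fst v) \<and> n \<le> snd v)"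
proof (induction P arbitrary: s n)
  case (RIn x y P)
  show ?case using RIn.IH[of s "Suc n"] by (cases "(s, n) = v") (auto simp: of_bool_def split: if_splits)
next
  case (ROut x y P)
  show ?case using ROut.IH[of s "Suc n"] by (cases "(s, n) = v") (auto simp: of_bool_def split: if_splits)
next
  case (RPar P Q)
  show ?case
    using add_mono[OF RPar.IH(1)[of "s @ [False]" n] RPar.IH(2)[of "s @ [True]" n]]
      of_bool_prefix_split[of s "fst v" "n \<le> snd v"]
    by simp
qed auto

lift_definition budget :: "label \<Rightarrow> 'n lterm \<Rightarrow> nat" is rbudget by (rule lalpha_rbudget)

lemma budget_simps [simp]:
  "budget v LNil = 0" "budget v (LIn u x y E) = of_bool (u = v) + budget v E"
  "budget v (LOut u x y E) = of_bool (u = v) + budget v E"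
  "budget v (LPar E F) = budget v E + budget v F" "budget v (LRes y E) = budget v E"
  "budget v (LRep u P) = of_bool (prefix (fst u) (fst v) \<and> snd u \<le> snd v)"
  "budget v (Emb P) = 0"
  by (transfer; simp)+

lemma budget_lsubst [simp]: "budget v (lsubst z y E) = budget v E"
  unfolding lsubst_def by transfer (rule rbudget_rlsubst)

lemma budget_labeling: "budget v (labeling s n P) \<le> of_bool (prefix s (fst v) \<and> n \<le> snd v)"
  by transfer (rule rbudget_rlabel)

text \<open>The bound has \<open>Suc n\<close> instead of \<open>n\<close>, so it vanishes at the
  label \<open>(s, n)\<close> of the replication itself: unfolding consumes that label.\<close>

lemma budget_Rep:
  "budget v (LPar (labeling (s @ [False]) (Suc n) Q) (LRep (s @ [True], Suc n) P))
    \<le> of_bool (prefix s (fst v) \<and> Suc n \<le> snd v)"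
  using budget_labeling[of v "s @ [False]" "Suc n" Q] of_bool_prefix_split[of s "fst v" "Suc n \<le> snd v"]
  by simp

lemma lstep_budget: "lstep E \<mu> E' \<Longrightarrow> budget v E' \<le> budget v E"
proof (induction rule: lstep.induct)
  case (Rep P \<mu> P' s n)
  have "of_bool (prefix s (fst v) \<and> Suc n \<le> snd v) \<le> budget v (LRep (s, n) P)"
    by auto
  with budget_Rep show ?case
    unfolding Suc_eq_plus1[symmetric] by (rule le_trans)
qed auto

text \<open>The induction runs over all actions, since a communication is assembled from two visible
  ones. The partner of the action that consumes \<open>v\<close> cannot raise the budget again, by
  \<open>lstep_budget\<close>.\<close>

lemma live_consume: "live v \<mu> S \<Longrightarrow> \<exists>S'. lstep S \<mu> S' \<and> budget v S' < budget v S"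
proof (induction rule: live.induct)
  case (Input v x z y S)
  show ?case by (intro exI conjI, rule lstep.Input) simp
next
  case (Output v x z S)
  show ?case by (intro exI conjI, rule lstep.Output) simp
next
  case (Res v \<mu> S y)
  then show ?case by (metis lstep.Res budget_simps(5))
next
  case (Open v x y S)
  then show ?case by (metis lstep.Open budget_simps(5))
next
  case (Rep P \<mu> P' v)
  obtain s n where v: "v = (s, n)" by (cases v)
  show ?case
    using lstep.Rep[OF Rep, of s n] budget_Rep[of v s n P' P] unfolding v by fastforce
next
  case (ParL v \<mu> S T)
  then show ?case by (metis lstep.ParL budget_simps(4) add_less_cancel_right)
next
  case (ParR v \<mu> T S)
  then show ?case by (metis lstep.ParR budget_simps(4) add_less_cancel_left)
next
  case (ComL_in v x y S w T)
  then obtain S' T' where "lstep S (AIn x y) S'" "lstep T (AOut x y) T'" "budget v S' < budget v S"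
    by blast
  then show ?case using lstep.ComL[of S x y S' T T'] lstep_budget[of T _ T' v] by fastforce
next
  case (ComL_out v x y S w T)
  then obtain S' T' where "lstep S (AIn x y) S'" "lstep T (AOut x y) T'" "budget w T' < budget w T"
    by blast
  then show ?case using lstep.ComL[of S x y S' T T'] lstep_budget[of S _ S' w] by fastforce
next
  case (ComR_in v x y T w S)
  then obtain S' T' where "lstep S (AOut x y) S'" "lstep T (AIn x y) T'" "budget v T' < budget v T"
    by blast
  then show ?case using lstep.ComR[of S x y S' T T'] lstep_budget[of S _ S' v] by fastforce
next
  case (ComR_out v x y T w S)
  then obtain S' T' where "lstep S (AOut x y) S'" "lstep T (AIn x y) T'" "budget w S' < budget w S"
    by blast
  then show ?case using lstep.ComR[of S x y S' T T'] lstep_budget[of T _ T' w] by fastforce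
next
  case (CloseL_in v x y S w T)
  then obtain S' T' where "lstep S (AIn x y) S'" "lstep T (ABOut x y) T'" "budget v S' < budget v S"
    by blast
  \<comment> \<open>Liveness by a \<open>Close\<close> rule concerns a term that already restricts
    \<open>y\<close>, so the closing transition happens under \<open>LRes y\<close> and its target
    has two nested restrictions.\<close>
  then show ?case
    using lstep.Res[OF lstep.CloseL[of S x y S' T T'], of y] CloseL_in lstep_budget[of T _ T' v]
    by (fastforce simp: an_def)
next
  case (CloseL_out v x y S w T)
  then obtain S' T' where "lstep S (AIn x y) S'" "lstep T (ABOut x y) T'" "budget w T' < budget w T"
    by blast
  then show ?case
    using lstep.Res[OF lstep.CloseL[of S x y S' T T'], of y] CloseL_out lstep_budget[of S _ S' w]
    by (fastforce simp: an_def)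
next
  case (CloseR_in v x y T w S)
  then obtain S' T' where "lstep S (ABOut x y) S'" "lstep T (AIn x y) T'" "budget v T' < budget v T"
    by blast
  then show ?case
    using lstep.Res[OF lstep.CloseR[of S x y S' T T'], of y] CloseR_in lstep_budget[of S _ S' v]
    by (fastforce simp: an_def)
next
  case (CloseR_out v x y T w S)
  then obtain S' T' where "lstep S (ABOut x y) S'" "lstep T (AIn x y) T'" "budget w S' < budget w S"
    by blast
  then show ?case
    using lstep.Res[OF lstep.CloseR[of S x y S' T T'], of y] CloseR_out lstep_budget[of T _ T' w]
    by (fastforce simp: an_def)
qed


subsection \<open>A strong-fair scheduler\<close>

lemma maximal_computation_iterate:
  assumes next_step: "\<And>T. \<exists>T'. lstep T ATau T' \<Longrightarrow> lstep T ATau (next T)"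
  obtains N where "maximal_computation S N (\<lambda>i. (next ^^ i) S)"
proof (cases "\<exists>n. \<nexists>T. lstep ((next ^^ n) S) ATau T")
  case True
  \<comment> \<open>Cutting at the least stuck index ensures that all earlier states can
    move.\<close>
  define n where "n = (LEAST n. \<nexists>T. lstep ((next ^^ n) S) ATau T)"
  have stuck: "\<nexists>T. lstep ((next ^^ n) S) ATau T"
    unfolding n_def using True by (rule LeastI_ex)
  have "lstep ((next ^^ i) S) ATau ((next ^^ Suc i) S)" if "i < n" for i
    using not_less_Least[OF that[unfolded n_def]] next_step[of "(next ^^ i) S"] by simp
  then have "maximal_computation S (enat n) (\<lambda>i. (next ^^ i) S)"
    unfolding maximal_computation_def using stuck by (simp del: not_ex)
  then show ?thesis by (rule that)
next
  case False
  then have "lstep ((next ^^ i) S) ATau ((next ^^ Suc i) S)" for i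
    using next_step[of "(next ^^ i) S"] by simp
  then have "maximal_computation S \<infinity> (\<lambda>i. (next ^^ i) S)"
    unfolding maximal_computation_def by simp
  then show ?thesis by (rule that)
qed

lemma nonincreasing_nat_eventually_constant:
  fixes f :: "nat \<Rightarrow> nat"
  assumes "\<And>i. f (Suc i) \<le> f i"
  obtains k where "\<And>j. j \<ge> k \<Longrightarrow> f (Suc j) = f j"
proof -
  \<comment> \<open>The sequence stays constant once it has attained its minimum.\<close>
  obtain k where k: "\<And>j. f k \<le> f j"
    using ex_has_least_nat[of "\<lambda>_. True" undefined f] by blast
  have const: "f j = f k" if "j \<ge> k" for j
    using lift_Suc_antimono_le[of f, OF assms that] k[of j] by (rule antisym)
  have "f (Suc j) = f j" if "j \<ge> k" for j
    unfolding const[OF that] using that by (intro const) simp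
  then show ?thesis by (rule that)
qed

text \<open>One choice serves all live labels at once, namely the live label that comes first in the
  enumeration. A term without live labels may still have transitions, for example inside
  \<open>Emb\<close>; then any step will do.\<close>

lemma exists_consuming_step:
  assumes "\<exists>T. lstep S ATau T"
  shows "\<exists>T. lstep S ATau T \<and>
    (\<forall>v \<in> live_labels S. \<exists>w. to_nat w \<le> to_nat v \<and> budget w T < budget w S)"
proof (cases "live_labels S = {}")
  case False
  then obtain u where u: "u \<in> live_labels S" by blast
  define w where "w = arg_min to_nat (\<lambda>v. v \<in> live_labels S)"
  have w: "w \<in> live_labels S"
    unfolding w_def using u by (rule arg_min_natI)
  have min: "to_nat w \<le> to_nat v" if "v \<in> live_labels S" for v
    unfolding w_def using that by (rule arg_min_nat_le)
  from w obtain T where "lstep S ATau T" "budget w T < budget w S"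
    using live_consume unfolding live_labels_def by blast
  then show ?thesis using min by blast
qed (use assms in simp)

lemma strong_fair_exists: "\<exists>N c. maximal_computation S N c \<and> strong_fair N c"
proof -
  define nxt where "nxt T = (SOME T'. lstep T ATau T' \<and>
    (\<forall>v \<in> live_labels T. \<exists>w. to_nat w \<le> to_nat v \<and> budget w T' < budget w T))" for T :: "'a lterm"
  have nxt: "lstep T ATau (nxt T) \<and>
      (\<forall>v \<in> live_labels T. \<exists>w. to_nat w \<le> to_nat v \<and> budget w (nxt T) < budget w T)"
    if "\<exists>T'. lstep T ATau T'" for T
    unfolding nxt_def using exists_consuming_step[OF that] by (rule someI_ex)
  define c where "c = (\<lambda>i. (nxt ^^ i) S)"
  obtain N where N: "maximal_computation S N c"
    unfolding c_def
  proof (rule maximal_computation_iterate)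
    show "\<exists>T'. lstep T ATau T' \<Longrightarrow> lstep T ATau (nxt T)" for T
      using nxt by blast
  qed
  have "\<exists>i. enat i \<le> N \<and> (\<forall>j\<ge>i. enat j \<le> N \<longrightarrow> v \<notin> live_labels (c j))" for v
  proof (cases N)
    case (enat n)
    \<comment> \<open>A stuck state has no live label, since \<open>live_consume\<close> would
      provide a transition.\<close>
    have "v \<notin> live_labels (c n)"
      using N live_consume enat unfolding maximal_computation_def live_labels_def by blast
    then show ?thesis using enat by (intro exI[of _ n]) auto
  next
    case infinity
    define f where "f i = (\<Sum>w | to_nat w \<le> to_nat v. budget w (c i))" for i
    have fin: "finite {w :: label. to_nat w \<le> to_nat v}"
      using finite_vimageI[OF finite_atMost inj_to_nat, of "to_nat v"]
      by (simp add: vimage_def)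
    have step: "lstep (c i) ATau (c (Suc i))" for i
      using N infinity unfolding maximal_computation_def by simp
    have "f (Suc i) \<le> f i" for i
      unfolding f_def by (intro sum_mono lstep_budget[OF step])
    then obtain k where k: "\<And>j. j \<ge> k \<Longrightarrow> f (Suc j) = f j"
      using nonincreasing_nat_eventually_constant by blast
    have "f (Suc j) < f j" if live: "v \<in> live_labels (c j)" for j
    proof -
      obtain w where w: "to_nat w \<le> to_nat v" "budget w (c (Suc j)) < budget w (c j)"
        using nxt[of "c j"] live step[of j] unfolding c_def by auto
      show ?thesis
        unfolding f_def using w by (intro sum_strict_mono_ex1 fin ballI lstep_budget[OF step]) blast
    qed
    then have "v \<notin> live_labels (c j)" if "j \<ge> k" for j
      using k[OF that] by fastforce
    then show ?thesis using infinity by (intro exI[of _ k]) auto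
  qed
  then show ?thesis using N unfolding strong_fair_def by blast
qed

lemma strong_fair_imp_weak_fair: "strong_fair N c \<Longrightarrow> weak_fair N c"
  unfolding strong_fair_def weak_fair_def
proof (intro allI impI)
  fix v i
  assume "\<forall>v. \<exists>i. enat i \<le> N \<and> (\<forall>j\<ge>i. enat j \<le> N \<longrightarrow> v \<notin> live_labels (c j))" and i: "enat i \<le> N"
  then obtain k where "enat k \<le> N" "\<forall>j\<ge>k. enat j \<le> N \<longrightarrow> v \<notin> live_labels (c j)"
    by blast
  then show "\<exists>j\<ge>i. enat j \<le> N \<and> v \<notin> live_labels (c j)"
    \<comment> \<open>Neither \<open>i\<close> nor \<open>k\<close> exceeds \<open>N\<close>, so
      their maximum is still an index of the computation.\<close>
    using i by (intro exI[of _ "max i k"]) (auto simp: max_def)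
qed


subsection \<open>Inversion of live labels\<close>

text \<open>\<open>rlsubst id\<close> computes a normal form with respect to alpha-conversion.\<close>

lemma lalpha_iff_rlsubst: "lalpha E F \<longleftrightarrow> rlsubst id E = rlsubst id F"
  by (metis lalpha_rlsubst rlsubst_id lalpha.sym lalpha.trans)

lemma PIn_distinct:
  "PIn x y P \<noteq> POut x' y' Q" "PIn x y P \<noteq> PSucc Q" "PIn x y P \<noteq> PPar Q R"
  "PIn x y P \<noteq> PRes x' Q" "PIn x y P \<noteq> PRep (Q :: 'n::infinite proc)"
  by (transfer; simp add: alpha_iff_rsubst Let_def)+

lemma PIn_inject: "PIn x y P = PIn x' y' (Q :: 'n::infinite proc) \<Longrightarrow> x = x'"
  by transfer (simp add: alpha_iff_rsubst Let_def)

lemma step_PInE: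
  assumes "step (PIn x y P) \<mu> P'"
  obtains z where "\<mu> = AIn x z"
  using assms by cases (auto simp: PIn_distinct dest: PIn_inject)

lemma lterm_distinct:
  fixes E F G :: "'n::infinite lterm" and P :: "'n proc"
  shows "LNil \<noteq> LIn v x y E" "LNil \<noteq> LOut v x y E" "LNil \<noteq> LPar E F" "LNil \<noteq> LRes x E"
    "LNil \<noteq> LRep v P" "LIn v x y E \<noteq> LOut w x' y' F" "LIn v x y E \<noteq> LPar F G"
    "LIn v x y E \<noteq> LRes x' F" "LIn v x y E \<noteq> LRep w P" "LOut v x y E \<noteq> LPar F G"
    "LOut v x y E \<noteq> LRes x' F" "LOut v x y E \<noteq> LRep w P" "LPar E F \<noteq> LRes x G"
    "LPar E F \<noteq> LRep v P" "LRes x E \<noteq> LRep v P"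
  by (transfer; simp add: lalpha_iff_rlsubst Let_def)+

text \<open>For \<open>LIn\<close> only label and channel are recovered, because bound name and body
  are fixed only up to alpha-conversion. Liveness of an input depends on nothing else.\<close>

lemma lterm_inject:
  fixes E F :: "'n::infinite lterm" and P :: "'n proc"
  shows "LIn v x y E = LIn v' x' y' F \<Longrightarrow> v = v' \<and> x = x'"
    "LOut v x y E = LOut v' x' y' F \<longleftrightarrow> v = v' \<and> x = x' \<and> y = y' \<and> E = F"
    "LPar E F = LPar E' F' \<longleftrightarrow> E = E' \<and> F = F'"
    "LRep v P = LRep v' P' \<longleftrightarrow> v = v' \<and> P = P'"
  by (transfer; simp add: lalpha_iff_rlsubst alpha_iff_rsubst Let_def)+

lemmas lterm_neq = lterm_distinct lterm_distinct[symmetric]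

lemma live_LNil: "\<not> live u \<mu> LNil"
  by (auto elim: live.cases[of u \<mu> LNil] simp: lterm_neq)

lemma live_LIn: "live u \<mu> (LIn v x y E) \<longleftrightarrow> u = v \<and> (\<exists>z. \<mu> = AIn x z)"
  by (auto intro: live.Input elim!: live.cases[of u \<mu> "LIn v x y E"]
      simp: lterm_neq dest: lterm_inject(1))

lemma live_LOut: "live u \<mu> (LOut v x y E) \<longleftrightarrow> u = v \<and> \<mu> = AOut x y"
  by (auto intro: live.Output elim!: live.cases[of u \<mu> "LOut v x y E"]
      simp: lterm_neq lterm_inject)

lemma live_LRep: "live u \<mu> (LRep v P) \<longleftrightarrow> u = v \<and> (\<exists>P'. step P \<mu> P')"
  by (auto intro: live.Rep elim!: live.cases[of u \<mu> "LRep v P"]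
      simp: lterm_neq lterm_inject)

lemma live_LRep_PIn: "live u \<mu> (LRep v (PIn x y P)) \<longleftrightarrow> u = v \<and> (\<exists>z. \<mu> = AIn x z)"
  unfolding live_LRep by (auto intro: step.Input elim: step_PInE)

lemma live_LPar_AIn: "live u (AIn x y) (LPar S T) \<longleftrightarrow> live u (AIn x y) S \<or> live u (AIn x y) T"
  by (auto intro: live.ParL live.ParR elim!: live.cases[of u _ "LPar S T"]
      simp: lterm_neq lterm_inject)

lemma live_LPar_AOut: "live u (AOut x y) (LPar S T) \<longleftrightarrow> live u (AOut x y) S \<or> live u (AOut x y) T"
  by (auto intro: live.ParL live.ParR elim!: live.cases[of u _ "LPar S T"]
      simp: lterm_neq lterm_inject)

text \<open>The \<open>Close\<close> rules contribute nothing here because their conclusions are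
  restrictions; hence bound outputs do not enter.\<close>

lemma live_LPar_ATau:
  "live u ATau (LPar S T) \<longleftrightarrow> live u ATau S \<or> live u ATau T \<or>
    (\<exists>x y w. live u (AIn x y) S \<and> live w (AOut x y) T \<or> live w (AIn x y) S \<and> live u (AOut x y) T \<or>
      live u (AIn x y) T \<and> live w (AOut x y) S \<or> live w (AIn x y) T \<and> live u (AOut x y) S)"
  (is "?L \<longleftrightarrow> ?R")
proof
  assume ?L
  then show ?R by (cases rule: live.cases) (auto simp: lterm_neq lterm_inject)
next
  assume ?R
  then show ?L
    by (auto intro: live.ParL live.ParR live.ComL_in live.ComL_out live.ComR_in live.ComR_out)
qed

lemmas live_simps = live_LNil live_LIn live_LOut live_LRep_PIn live_LPar_AIn live_LPar_AOut
  live_LPar_ATau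


subsection \<open>A weak-fair computation that is not strong-fair\<close>

context
  fixes a b x :: "'n::infinite"
  assumes names: "a \<noteq> b" "x \<noteq> a" "x \<noteq> b"
begin

definition sync :: "'n proc" where
  "sync = PPar (POut b a PNil) (PIn b x (POut a a PNil))"

text \<open>This is what remains of a replication labeled \<open>([True], 0)\<close> after
  \<open>k\<close> unfoldings: each one appends \<open>True\<close> and raises the counter.\<close>

definition server :: "nat \<Rightarrow> 'n lterm" where
  "server k = LRep (replicate (Suc k) True, k) (PIn a x sync)"

text \<open>Every round leaves an exhausted \<open>sync\<close> behind as
  \<open>LPar LNil LNil\<close>. Transitions do not remove inert components, so this residue
  accumulates.\<close>

definition garbage :: "nat \<Rightarrow> 'n lterm \<Rightarrow> 'n lterm" where
  "garbage k = (LPar (LPar LNil LNil) ^^ k)"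

text \<open>The outermost input is the process, everything else the observer. The message continues
  the input in the right half of a \<open>sync\<close> labeled from counter \<open>k\<close>, hence
  the ending \<open>[False, True]\<close> and the counter \<open>Suc k\<close>.\<close>

definition msg_state :: "nat \<Rightarrow> 'n lterm" where
  "msg_state k = LPar (LIn ([], 0) a x LNil) (garbage k
    (LPar (LPar LNil (LOut (replicate k True @ [False, True], Suc k) a a LNil)) (server k)))"

definition sync_state :: "nat \<Rightarrow> 'n lterm" where
  "sync_state k = LPar (LIn ([], 0) a x LNil) (garbage (Suc k)
    (LPar (labeling (replicate (Suc k) True @ [False]) (Suc k) sync) (server (Suc k))))"

definition alternation :: "nat \<Rightarrow> 'n lterm" where
  "alternation i = (if even i then msg_state (i div 2) else sync_state (i div 2))"

lemma garbage_Suc: "garbage (Suc k) E = garbage k (LPar (LPar LNil LNil) E)"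
  unfolding garbage_def by (simp add: funpow_swap1)

lemma lstep_garbage: "lstep E ATau E' \<Longrightarrow> lstep (garbage k E) ATau (garbage k E')"
  unfolding garbage_def by (induction k) (auto intro: lstep.ParR)

lemma live_garbage:
  "live u (AIn y z) (garbage k E) = live u (AIn y z) E"
  "live u (AOut y z) (garbage k E) = live u (AOut y z) E"
  "live u ATau (garbage k E) = live u ATau E"
  unfolding garbage_def by (induction k) (auto simp: live_simps)

section \<open>Transitions of the alternation\<close>

lemma msg_state_step: "lstep (msg_state k) ATau (sync_state k)"
proof -
  have "subst a x sync = sync"
    using names by (intro subst_fresh) (simp add: sync_def)
  then have "step (PIn a x sync) (AIn a a) sync"
    using step.Input[of a x sync a] by simp
  from lstep.Rep[OF this, of "replicate (Suc k) True" k]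
  have "lstep (server k) (AIn a a)
      (LPar (labeling (replicate (Suc k) True @ [False]) (Suc k) sync) (server (Suc k)))"
    by (simp add: server_def replicate_append_same)
  then show ?thesis
    \<comment> \<open>With the newest residue placed innermost, it is what the delivered message
      leaves beside the unfolded server.\<close>
    unfolding msg_state_def sync_state_def garbage_Suc
    by (intro lstep.ParR lstep_garbage lstep.ComR[of _ a a] lstep.Output) simp_all
qed

lemma sync_state_step: "lstep (sync_state k) ATau (msg_state (Suc k))"
proof -
  have fresh: "lsubst a x (LOut v a a LNil) = LOut v a a LNil" for v
    using names by (intro lsubst_fresh) simp
  have "lstep (LIn u b x (LOut v a a LNil)) (AIn b a) (LOut v a a LNil)" for u v
    using lstep.Input[of u b x "LOut v a a LNil" a] unfolding fresh .
  then have "lstep (labeling (replicate (Suc k) True @ [False]) (Suc k) sync) ATau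
      (LPar LNil (LOut (replicate (Suc k) True @ [False, True], Suc (Suc k)) a a LNil))"
    unfolding sync_def by (auto intro!: lstep.ComR lstep.Output)
  then show ?thesis
    unfolding msg_state_def sync_state_def
    by (intro lstep.ParR lstep_garbage lstep.ParL) simp_all
qed

section \<open>Live labels and fairness of the alternation\<close>

lemma live_labels_msg_state:
  "live_labels (msg_state k) =
    {([], 0), (replicate k True @ [False, True], Suc k), (replicate (Suc k) True, k)}"
  unfolding live_labels_def msg_state_def server_def
  by (auto simp: live_simps live_garbage)

text \<open>No output on \<open>a\<close> is unguarded here, so neither the ignored input nor the
  server is live.\<close>

lemma live_labels_sync_state:
  "live_labels (sync_state k) =
    {(replicate (Suc k) True @ [False, False], Suc k), (replicate (Suc k) True @ [False, True], Suc k)}"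
  unfolding live_labels_def sync_state_def server_def sync_def using names
  by (auto simp: live_simps live_garbage)

lemma live_labels_disjoint: "live_labels (msg_state k) \<inter> live_labels (sync_state k) = {}"
proof -
  \<comment> \<open>The lengths are \<open>k + 2\<close> and \<open>k + 3\<close>. The other labels
    live in \<open>msg_state k\<close> have strings without \<open>False\<close>.\<close>
  have "replicate k True @ [False, True] \<noteq> replicate (Suc k) True @ [False, d]" for d
    by (rule notI, drule arg_cong[of _ _ length]) simp
  then show ?thesis
    unfolding live_labels_msg_state live_labels_sync_state by (auto simp del: replicate.simps)
qed

lemma alternation_maximal: "maximal_computation (msg_state 0) \<infinity> alternation"
  unfolding maximal_computation_def alternation_def
  by (auto simp: msg_state_step sync_state_step elim!: evenE oddE)

lemma alternation_weak_fair: "weak_fair \<infinity> alternation"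
  unfolding weak_fair_def
proof (intro allI impI)
  fix v i
  \<comment> \<open>Both states of round \<open>i\<close> have indices at least \<open>i\<close>,
    and \<open>v\<close> is live in at most one of them.\<close>
  have "alternation (2 * i) = msg_state i" "alternation (Suc (2 * i)) = sync_state i"
    by (simp_all add: alternation_def)
  then have "v \<notin> live_labels (alternation (2 * i)) \<or> v \<notin> live_labels (alternation (Suc (2 * i)))"
    using live_labels_disjoint[of i] by auto
  moreover have "i \<le> 2 * i" "i \<le> Suc (2 * i)" by simp_all
  ultimately show "\<exists>j\<ge>i. enat j \<le> \<infinity> \<and> v \<notin> live_labels (alternation j)"
    using enat_ord_code(3) by blast
qed

lemma alternation_not_strong_fair: "\<not> strong_fair \<infinity> alternation"
proof
  assume "strong_fair \<infinity> alternation"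
  then obtain i where i: "\<And>j. j \<ge> i \<Longrightarrow> ([], 0) \<notin> live_labels (alternation j)"
    unfolding strong_fair_def by force
  have "([], 0) \<in> live_labels (alternation (2 * i))"
    by (simp add: alternation_def live_labels_msg_state)
  then show False using i[of "2 * i"] by simp
qed

lemma msg_state_0_experiment: "msg_state 0 \<in> labeled_experiments"
proof -
  have "wf_lterm (LIn ([], 0) a x LNil)"
    using wf_lterm.In[of "[]" 0 a x PNil] by simp
  moreover have "wf_lterm (LOut ([False, True], Suc 0) a a LNil)"
    using wf_lterm.Out[of "[False, True]" "Suc 0" a a PNil] by simp
  \<comment> \<open>The strings \<open>[False, True]\<close> and \<open>[True]\<close> are not
    prefixes of each other.\<close>
  then have "wf_lterm (LPar (LPar LNil (LOut ([False, True], Suc 0) a a LNil)) (server 0))"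
    unfolding server_def by (auto intro!: wf_lterm.intros simp: unrelated_def)
  moreover have "lomega_free (LIn ([], 0) a x LNil)" by simp
  ultimately show ?thesis
    unfolding labeled_experiments_def labeled_processes_def labeled_observers_def
      msg_state_def garbage_def
    by (simp only: funpow_0 replicate_0 append_Nil mem_Collect_eq) blast
qed

end

theorem theorem5p4:
  shows
    "(\<forall>S \<in> (labeled_experiments :: 'n::infinite lterm set).
        \<exists>N c. maximal_computation S N c \<and> strong_fair N c) \<and>
     (\<forall>S \<in> (labeled_experiments :: 'n lterm set).
        \<forall>N c. maximal_computation S N c \<and> strong_fair N c \<longrightarrow> weak_fair N c) \<and>
     (\<exists>S \<in> (labeled_experiments :: 'n lterm set).
        \<exists>N c. maximal_computation S N c \<and> weak_fair N c \<and> \<not> strong_fair N c)"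
proof -
  \<comment> \<open>The name \<open>undefined\<close> serves as \<open>a\<close>.\<close>
  obtain b :: 'n where b: "b \<notin> {undefined}"
    using ex_new_if_finite[OF infinite_UNIV] by (metis finite.emptyI finite.insertI)
  obtain x :: 'n where x: "x \<notin> {undefined, b}"
    using ex_new_if_finite[OF infinite_UNIV] by (metis finite.emptyI finite.insertI)
  have names: "undefined \<noteq> b" "x \<noteq> undefined" "x \<noteq> b" using b x by auto
  show ?thesis
    using strong_fair_exists strong_fair_imp_weak_fair msg_state_0_experiment[OF names]
      alternation_maximal[OF names] alternation_weak_fair[OF names]
      alternation_not_strong_fair[OF names]
    by blast
qed

end
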